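(* Let $(V,E)$ be a finite connected graph with $|V|=n$, let $a_0,a_1\in V$ be two distinct vertices, and for each edge $xy\in E$ let $R_{xy},L_{xy},D_{xy}\in[0,+\infty)$ with $R_{xy}^2+L_{xy}^2+D_{xy}^2\neq 0$. For a complex variable $\lambda$ put $\rho_{xy}(\lambda)=\dfrac{\lambda}{L_{xy}\lambda^2+R_{xy}\lambda+D_{xy}}$ for $xy\in E$ and $\rho_{xy}=0$ if $xy\notin E$. Consider the $n\times n$ linear system in the unknowns $v(x)$, $x\in V$: $$\sum_{y\in V}(v(y)-v(x))\rho_{xy}(\lambda)=0\ \ (x\in V\setminus\{a_0,a_1\}),\qquad v(a_0)=0,\qquad v(a_1)=1,$$ and let $D(\lambda)$ be the determinant of its coefficient matrix (a rational function of $\lambda$). Then $D(\lambda)$ has only finitely many zeros in $\mathbb{C}$.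
   Context: This models an electrical network: $R_{xy}$ is the resistance, $L_{xy}$ the inductance and $D_{xy}=1/C_{xy}$ the inverse capacitance of the edge $xy$; physically $\lambda=i\omega$ with frequency $\omega>0$, and $\rho_{xy}$ is the admittance (inverse of the impedance $z_{xy}=R_{xy}+L_{xy}\lambda+D_{xy}/\lambda$) of the edge. *)

theory Defs
  imports
    "HOL-Analysis.Analysis"
    "HOL-Computational_Algebra.Fraction_Field"
    "HOL-Computational_Algebra.Polynomial"
    "Graph_Theory.Digraph_Component"
begin

text \<open>
  Rational functions of the complex variable \<open>\<lambda>\<close> are elements of the fraction field
  \<open>complex poly fract\<close>, with \<open>\<lambda> = [:0, 1:]\<close>. In this way common factors cancel as they do for
  rational functions, and no value has to be assigned at a pole.
\<close>

text \<open>
  \<open>z\<close> is a zero if the function is regular at \<open>z\<close>, as witnessed by a representation whose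
  denominator does not vanish there, and has the value 0. Every point is a zero of the zero function.
\<close>

definition ratfun_zeros :: "complex poly fract \<Rightarrow> complex set" where
  "ratfun_zeros f = {z. \<exists>p q. f = Fract p q \<and> poly q z \<noteq> 0 \<and> poly p z = 0}"

text \<open>
  The parameters \<open>R\<close>, \<open>L\<close>, \<open>D\<close> are indexed by undirected edges \<open>{x, y}\<close>, whereas an undirected
  graph is a symmetric set of pairs \<open>(x, y)\<close>, as in the library of graphs.
\<close>

definition admittance ::
  "'v pair_pre_digraph \<Rightarrow> ('v set \<Rightarrow> real) \<Rightarrow> ('v set \<Rightarrow> real) \<Rightarrow> ('v set \<Rightarrow> real)
     \<Rightarrow> 'v \<Rightarrow> 'v \<Rightarrow> complex poly fract" where
  "admittance G R L D x y =
     (if (x, y) \<in> parcs G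
      then Fract [:0, 1:] [:of_real (D {x, y}), of_real (R {x, y}), of_real (L {x, y}):]
      else 0)"

text \<open>
  The left-hand sides of the equations, the equation of the vertex \<open>x\<close> being the one of index \<open>x\<close>;
  those of \<open>a0\<close> and \<open>a1\<close> are \<open>v(a0) = 0\<close> and \<open>v(a1) = 1\<close>.
\<close>

definition system_lhs ::
  "('v::finite \<Rightarrow> 'v \<Rightarrow> 'a::comm_ring_1) \<Rightarrow> 'v \<Rightarrow> 'v \<Rightarrow> 'a ^ 'v \<Rightarrow> 'a ^ 'v" where
  "system_lhs \<rho> a0 a1 v =
     (\<chi> x. if x \<in> UNIV - {a0, a1} then (\<Sum>y\<in>UNIV. (v $ y - v $ x) * \<rho> x y) else v $ x)"

definition coeff_matrix ::
  "('v::finite \<Rightarrow> 'v \<Rightarrow> 'a::comm_ring_1) \<Rightarrow> 'v \<Rightarrow> 'v \<Rightarrow> 'a ^ 'v ^ 'v" where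
  "coeff_matrix \<rho> a0 a1 = matrix (system_lhs \<rho> a0 a1)"

lemma coeff_matrix_mult_vec:
  fixes \<rho> :: "'v::finite \<Rightarrow> 'v \<Rightarrow> 'a::field"
  shows "coeff_matrix \<rho> a0 a1 *v v = system_lhs \<rho> a0 a1 v"
proof -
  have "Vector_Spaces.linear (*s) (*s) (system_lhs \<rho> a0 a1)"
    by unfold_locales
      (auto simp: system_lhs_def vec_eq_iff algebra_simps sum.distrib sum_subtractf sum_distrib_left)
  then show ?thesis
    unfolding coeff_matrix_def by (rule matrix_works)
qed

end

theory Submission
  imports Defs
begin

text \<open>
  At \<open>\<lambda> = 1\<close> every edge has the positive admittance \<open>1 / (L + R + D)\<close>, so that by the maximum
  principle the homogeneous system there has only the trivial solution. Hence the determinant is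
  regular and nonzero at \<open>1\<close>; it is therefore a nonzero rational function, and its zeros are among
  the roots of a nonzero polynomial.
\<close>

text \<open>A relation rather than a function, so that poles get no default value. Any
  representation with denominator nonzero at \<open>z\<close> may serve as witness, reduced or not,
  and the value is expressed without division.\<close>

definition ratfun_value :: "'a::field poly fract \<Rightarrow> 'a \<Rightarrow> 'a \<Rightarrow> bool" where
  "ratfun_value f z c \<longleftrightarrow> (\<exists>p q. f = Fract p q \<and> poly q z \<noteq> 0 \<and> poly p z = c * poly q z)"

lemma ratfun_valueI:
  "poly q z \<noteq> 0 \<Longrightarrow> poly p z = c * poly q z \<Longrightarrow> ratfun_value (Fract p q) z c"
  unfolding ratfun_value_def by blast

lemma ratfun_valueE:
  assumes "ratfun_value f z c"
  obtains p q where "f = Fract p q" "q \<noteq> 0" "poly q z \<noteq> 0" "poly p z = c * poly q z"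
  using assms unfolding ratfun_value_def by (metis poly_0)

lemma ratfun_value_0: "ratfun_value 0 z 0"
  unfolding Zero_fract_def by (rule ratfun_valueI) simp_all

lemma ratfun_value_1: "ratfun_value 1 z 1"
  unfolding One_fract_def by (rule ratfun_valueI) simp_all

lemma ratfun_value_uminus: "ratfun_value f z c \<Longrightarrow> ratfun_value (- f) z (- c)"
  by (elim ratfun_valueE) (simp add: ratfun_valueI)

lemma ratfun_value_add:
  "ratfun_value f z c \<Longrightarrow> ratfun_value g z d \<Longrightarrow> ratfun_value (f + g) z (c + d)"
  by (elim ratfun_valueE) (simp add: ratfun_valueI algebra_simps)

lemma ratfun_value_diff:
  "ratfun_value f z c \<Longrightarrow> ratfun_value g z d \<Longrightarrow> ratfun_value (f - g) z (c - d)"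
  using ratfun_value_add[OF _ ratfun_value_uminus] by fastforce

lemma ratfun_value_mult:
  "ratfun_value f z c \<Longrightarrow> ratfun_value g z d \<Longrightarrow> ratfun_value (f * g) z (c * d)"
  by (elim ratfun_valueE) (simp add: ratfun_valueI algebra_simps)

lemma ratfun_value_sum:
  "(\<And>i. i \<in> A \<Longrightarrow> ratfun_value (f i) z (c i)) \<Longrightarrow> ratfun_value (sum f A) z (sum c A)"
  by (induction A rule: infinite_finite_induct) (auto intro: ratfun_value_0 ratfun_value_add)

lemma ratfun_value_prod:
  "(\<And>i. i \<in> A \<Longrightarrow> ratfun_value (f i) z (c i)) \<Longrightarrow> ratfun_value (prod f A) z (prod c A)"
  by (induction A rule: infinite_finite_induct) (auto intro: ratfun_value_1 ratfun_value_mult)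

text \<open>If \<open>Fract p q\<close> is zero with \<open>q\<close> nonzero, then \<open>p\<close>
  is zero, so \<open>c * poly q z = 0\<close>. By contraposition, a single nonzero value shows that
  a rational function is not the zero function.\<close>

lemma ratfun_value_zero_imp: "ratfun_value 0 z c \<Longrightarrow> c = 0"
  by (elim ratfun_valueE) (auto simp: Zero_fract_def eq_fract)

text \<open>The Leibniz formula builds the determinant from the entries by ring operations, and
  these respect values at \<open>z\<close>.\<close>

lemma ratfun_value_det:
  fixes A :: "'a::field poly fract ^ 'n ^ 'n"
  assumes "\<And>i j. ratfun_value (A $ i $ j) z (B $ i $ j)"
  shows "ratfun_value (det A) z (det B)"
  unfolding det_def
proof (intro ratfun_value_sum ratfun_value_mult ratfun_value_prod assms)
  fix p :: "'n \<Rightarrow> 'n"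
  show "ratfun_value (of_int (sign p)) z (of_int (sign p))"
    by (cases p rule: sign_cases) (simp_all add: ratfun_value_1 ratfun_value_uminus)
qed

text \<open>Each entry is a component of \<open>system_lhs\<close> at a standard basis vector, hence
  a ring expression in the weights, 0 and 1.\<close>

lemma ratfun_value_coeff_matrix:
  assumes "\<And>x y. ratfun_value (\<rho> x y) z (c x y)"
  shows "ratfun_value (coeff_matrix \<rho> a b $ x $ y) z (coeff_matrix c a b $ x $ y)"
proof -
  have "ratfun_value (axis y 1 $ i) z (axis y 1 $ i)" for i
    by (simp add: axis_def ratfun_value_0 ratfun_value_1)
  then show ?thesis
    unfolding coeff_matrix_def matrix_def system_lhs_def
    by (auto intro!: ratfun_value_sum ratfun_value_mult ratfun_value_diff assms)
qed

text \<open>One fixed representation suffices: cross-multiplying it with any representation that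
  witnesses a zero shows that this zero is a root of the fixed numerator, which is a nonzero
  polynomial.\<close>

lemma finite_ratfun_zeros:
  assumes "f \<noteq> 0"
  shows "finite (ratfun_zeros f)"
proof -
  obtain a b where ab: "f = Fract a b" "b \<noteq> 0" "a \<noteq> 0"
    using assms by (cases f rule: Fract_cases_nonzero) auto
  have "ratfun_zeros f \<subseteq> {z. poly a z = 0}"
  proof (clarsimp simp: ratfun_zeros_def)
    fix z p q
    assume f: "f = Fract p q" and q: "poly q z \<noteq> 0" and p: "poly p z = 0"
    have "a * q = p * b"
      using ab f q by (metis eq_fract poly_0)
    then have "poly a z * poly q z = poly p z * poly b z"
      by (metis poly_mult)
    with p q show "poly a z = 0"
      by simp
  qed
  then show ?thesis
    using poly_roots_finite[OF ab(3)] finite_subset by blast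
qed

text \<open>At a vertex other than \<open>a\<close> and \<open>b\<close> the equation balances the
  weighted differences to the other vertices. A positive maximum would therefore spread along the
  edges of positive weight until it reaches \<open>a\<close>, where \<open>v\<close>
  vanishes.\<close>

lemma system_lhs_maximum_principle:
  fixes \<rho> :: "'v::finite \<Rightarrow> 'v \<Rightarrow> 'a::linordered_field"
  assumes nonneg: "\<And>x y. \<rho> x y \<ge> 0"
    and reach: "\<And>x y. (x, y) \<in> {(x, y). \<rho> x y > 0}\<^sup>*"
    and v: "system_lhs \<rho> a b v = 0"
  shows "v $ x \<le> 0"
proof (rule ccontr)
  assume "\<not> v $ x \<le> 0"
  define M where "M = Max (range (($) v))"
  have le: "v $ y \<le> M" for y
    unfolding M_def by (rule Max_ge) auto
  have "M \<in> range (($) v)"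
    unfolding M_def by (rule Max_in) auto
  then obtain m where m: "v $ m = M"
    by auto
  have "M > 0"
    using le[of x] \<open>\<not> v $ x \<le> 0\<close> by linarith
  have va: "v $ a = 0"
    using v by (auto simp: system_lhs_def vec_eq_iff split: if_splits)
  have "v $ y = M" if "(m, y) \<in> {(x, y). \<rho> x y > 0}\<^sup>*" for y
    using that
  proof (induction rule: rtrancl_induct)
    case base
    show ?case by (fact m)
  next
    case (step y z)
    have "system_lhs \<rho> a b v $ y = 0"
      using v by simp
    \<comment> \<open>The vertex \<open>y\<close> is neither \<open>a\<close> nor \<open>b\<close>:
      there \<open>v\<close> is 0, whereas \<open>v $ y = M > 0\<close>.\<close>
    then have "(\<Sum>w\<in>UNIV. (v $ w - v $ y) * \<rho> y w) = 0"
      using \<open>M > 0\<close> step.IH by (auto simp: system_lhs_def split: if_splits)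
    then have "(\<Sum>w\<in>UNIV. (M - v $ w) * \<rho> y w) = 0"
      using step.IH by (simp add: left_diff_distrib sum_subtractf)
    \<comment> \<open>All summands are nonnegative because \<open>M\<close> is the maximum, so each
      of them vanishes; the one for \<open>z\<close> has a positive weight.\<close>
    then have "(M - v $ z) * \<rho> y z = 0"
      by (subst (asm) sum_nonneg_eq_0_iff) (auto simp: le nonneg)
    with step.hyps show ?case
      by auto
  qed
  with reach[of m a] va \<open>M > 0\<close> show False
    by simp
qed

text \<open>By linearity the maximum principle applies to both \<open>v\<close> and
  \<open>- v\<close>.\<close>

lemma system_lhs_eq_0_imp:
  fixes \<rho> :: "'v::finite \<Rightarrow> 'v \<Rightarrow> 'a::linordered_field"
  assumes "\<And>x y. \<rho> x y \<ge> 0"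
    and "\<And>x y. (x, y) \<in> {(x, y). \<rho> x y > 0}\<^sup>*"
    and v: "system_lhs \<rho> a b v = 0"
  shows "v = 0"
proof -
  have "system_lhs \<rho> a b (- v) = - system_lhs \<rho> a b v"
    by (simp add: system_lhs_def vec_eq_iff left_diff_distrib sum_subtractf)
  then have "(- v) $ x \<le> 0" for x
    using system_lhs_maximum_principle[OF assms(1,2), of a b "- v"] v by simp
  moreover have "v $ x \<le> 0" for x
    using assms by (rule system_lhs_maximum_principle)
  ultimately show ?thesis
    by (simp add: vec_eq_iff order_antisym)
qed

text \<open>The maximum principle needs an ordered field. Since the weights are real, the real and
  imaginary parts of a complex kernel vector each solve the real homogeneous system, so the kernel
  is trivial.\<close>

lemma det_coeff_matrix_of_real_nonzero:
  fixes c :: "'v::finite \<Rightarrow> 'v \<Rightarrow> real"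
  assumes "\<And>x y. c x y \<ge> 0"
    and "\<And>x y. (x, y) \<in> {(x, y). c x y > 0}\<^sup>*"
  shows "det (coeff_matrix (\<lambda>x y. complex_of_real (c x y)) a b) \<noteq> 0"
proof -
  have "v = 0" if v: "coeff_matrix (\<lambda>x y. complex_of_real (c x y)) a b *v v = 0" for v
  proof -
    have "system_lhs (\<lambda>x y. complex_of_real (c x y)) a b v $ x = 0" for x
      using v by (simp add: coeff_matrix_mult_vec)
    then have "Re (system_lhs (\<lambda>x y. complex_of_real (c x y)) a b v $ x) = 0"
      and "Im (system_lhs (\<lambda>x y. complex_of_real (c x y)) a b v $ x) = 0" for x
      by simp_all
    then have "system_lhs c a b (\<chi> x. Re (v $ x)) = 0" "system_lhs c a b (\<chi> x. Im (v $ x)) = 0"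
      by (auto simp: system_lhs_def vec_eq_iff if_distrib[of Re] if_distrib[of Im] cong: if_cong)
    then have "(\<chi> x. Re (v $ x)) = 0" "(\<chi> x. Im (v $ x)) = 0"
      using system_lhs_eq_0_imp[OF assms] by blast+
    then show "v = 0"
      by (simp add: vec_eq_iff complex_eq_iff)
  qed
  then show ?thesis
    by (simp add: invertible_det_nz[symmetric] invertible_left_inverse matrix_left_invertible_ker)
qed

text \<open>Connectedness of a digraph means strong connectedness of its symmetric closure; for a
  symmetric digraph, reachability is the same in both.\<close>

lemma (in pair_sym_digraph) connected_imp_rtrancl:
  assumes "Digraph_Component.connected (with_proj G)" "x \<in> pverts G" "y \<in> pverts G"
  shows "(x, y) \<in> (parcs G)\<^sup>*"
proof -
  have "x \<rightarrow>\<^sup>*\<^bsub>with_proj (mk_symmetric (with_proj G))\<^esub> y"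
    using assms by (auto simp: connected_def strongly_connected_def)
  then have "x \<rightarrow>\<^sup>*\<^bsub>with_proj G\<^esub> y"
    using reachable_mk_symmetric_eq[OF sym_arcs] by simp
  then show ?thesis
    by (induction rule: reachable_induct) auto
qed

theorem theorem2p4:
  fixes G :: "'v::finite pair_pre_digraph"
    and a0 a1 :: 'v
    and R L D :: "'v set \<Rightarrow> real"
  assumes "pair_graph G"
    and "pverts G = UNIV"
    and "Digraph_Component.connected (with_proj G)"
    and "a0 \<noteq> a1"
    and "\<And>x y. (x, y) \<in> parcs G \<Longrightarrow> R {x, y} \<ge> 0 \<and> L {x, y} \<ge> 0 \<and> D {x, y} \<ge> 0"
    and "\<And>x y. (x, y) \<in> parcs G \<Longrightarrow> (R {x, y})\<^sup>2 + (L {x, y})\<^sup>2 + (D {x, y})\<^sup>2 \<noteq> 0"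
  shows "finite (ratfun_zeros (det (coeff_matrix (admittance G R L D) a0 a1)))"
proof -
  interpret pair_graph G by fact
  \<comment> \<open>The denominator of the admittance at \<lambda> = 1; \<open>c\<close> below is
    the resulting value of the admittance.\<close>
  define s where "s x y = D {x, y} + R {x, y} + L {x, y}" for x y
  define c where "c x y = (if (x, y) \<in> parcs G then 1 / s x y else 0)" for x y
  have s: "s x y > 0" if "(x, y) \<in> parcs G" for x y
  proof -
    have "R {x, y} \<noteq> 0 \<or> L {x, y} \<noteq> 0 \<or> D {x, y} \<noteq> 0"
      using assms(6)[OF that] by auto
    then show ?thesis
      using assms(5)[OF that] unfolding s_def by linarith
  qed
  have val: "ratfun_value (admittance G R L D x y) 1 (complex_of_real (c x y))" for x y
  proof (cases "(x, y) \<in> parcs G")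
    case True
    let ?q = "[:of_real (D {x, y}), of_real (R {x, y}), of_real (L {x, y}):] :: complex poly"
    have q: "poly ?q 1 = of_real (s x y)"
      by (simp add: s_def)
    have "ratfun_value (Fract [:0, 1:] ?q) 1 (of_real (c x y))"
    proof (rule ratfun_valueI)
      show "poly ?q 1 \<noteq> 0"
        unfolding q using s[OF True] by simp
      show "poly [:0, 1:] 1 = of_real (c x y) * poly ?q 1"
        unfolding q using True s[OF True] by (simp add: c_def)
    qed
    then show ?thesis
      using True by (simp add: admittance_def)
  next
    case False
    then show ?thesis
      by (simp add: admittance_def c_def ratfun_value_0)
  qed
  have "c x y \<ge> 0" for x y
    using s[of x y] by (auto simp: c_def)
  \<comment> \<open>The edges of positive weight are exactly those of \<open>G\<close>, so
    connectedness of \<open>G\<close> supplies the paths that the maximum principle follows.\<close>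
  moreover have "{(x, y). c x y > 0} = parcs G"
    using s by (auto simp: c_def split: if_splits)
  then have "(x, y) \<in> {(x, y). c x y > 0}\<^sup>*" for x y
    using connected_imp_rtrancl[OF assms(3)] assms(2) by simp
  ultimately have "det (coeff_matrix (\<lambda>x y. complex_of_real (c x y)) a0 a1) \<noteq> 0"
    by (rule det_coeff_matrix_of_real_nonzero)
  moreover have "ratfun_value (det (coeff_matrix (admittance G R L D) a0 a1)) 1
      (det (coeff_matrix (\<lambda>x y. complex_of_real (c x y)) a0 a1))"
    by (intro ratfun_value_det ratfun_value_coeff_matrix val)
  ultimately have "det (coeff_matrix (admittance G R L D) a0 a1) \<noteq> 0"
    using ratfun_value_zero_imp by fastforce
  then show ?thesis
    by (rule finite_ratfun_zeros)
qed

end
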